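(* Let $G$ be a finite group, $N$ a normal subgroup of $G$, and let $p$ be the smallest prime number dividing $|G|$. Then (i) $\displaystyle \frac{d(G,N)}{|\mathcal{M}(G,N)|}+\frac{|Z^{\wedge}(G,N)|}{|G|}\left(1-\frac{1}{|\mathcal{M}(G,N)|}\right)\leq d^{\wedge}(G,N)$; (ii) $\displaystyle d^{\wedge}(G,N)\leq d(G,N)-\left(\frac{p-1}{p}\right)\left(\frac{|Z(G,N)|-|Z^{\wedge}(G,N)|}{|N|}\right)$.
   Context: Let $N\unlhd G$, with $G$ and $N$ acting on each other and on themselves by conjugation, ${}^{x}y=xyx^{-1}$. The non-abelian tensor product $G\otimes N$ is the group generated by symbols $g\otimes n$ ($g\in G$, $n\in N$) subject to the relations $gg'\otimes n=({}^gg'\otimes{}^gn)(g\otimes n)$ and $g\otimes nn'=(g\otimes n)({}^ng\otimes{}^nn')$ for all $g,g'\in G$, $n,n'\in N$. The exterior product $G\wedge N$ is the quotient of $G\otimes N$ obtained by imposing the additional relations $x\otimes x=1$ for all $x\in N$; the image of $g\otimes n$ is denoted $g\wedge n$. The Schur multiplier of the pair, $\mathcal{M}(G,N)$, is the kernel of the commutator homomorphism $\kappa:G\wedge N\to[G,N]$, $g\wedge n\mapsto[g,n]=gng^{-1}n^{-1}$. For a finite group $G$ with $N\unlhd G$: - the exterior degree is $d^{\wedge}(G,N)=\frac{1}{|G||N|}\,|\{(g,n)\in G\times N : g\wedge n=1 \text{ in } G\wedge N\}|$; - the relative commutativity degree is $d(G,N)=\frac{1}{|G||N|}\,|\{(x,y)\in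 G\times N : xy=yx\}|$; - the exterior $G$-centre of $N$ is $Z^{\wedge}(G,N)=\{n\in N : g\wedge n=1 \text{ in } G\wedge N \text{ for all } g\in G\}$; - $Z(G,N)=\{n\in N : gng^{-1}=n \text{ for all } g\in G\}=N\cap Z(G)$. *)

theory Defs
  imports Complex_Main "HOL-Algebra.Generated_Groups" "HOL-Computational_Algebra.Primes"
begin

section \<open>Groups given by generators and relations\<close>

text \<open>
  A letter \<open>(x, True)\<close> stands for the generator \<open>x\<close> and \<open>(x, False)\<close> for its formal inverse.
  A relation is a pair \<open>(l, r)\<close> of words, read as the equation \<open>l = r\<close>.
\<close>

type_synonym 'x gword = "('x \<times> bool) list"

definition gwords :: "'x set \<Rightarrow> 'x gword set" where
  "gwords X = lists (X \<times> UNIV)"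

inductive pres_eq :: "'x set \<Rightarrow> ('x gword \<times> 'x gword) set \<Rightarrow> 'x gword \<Rightarrow> 'x gword \<Rightarrow> bool"
  for X R where
  refl: "w \<in> gwords X \<Longrightarrow> pres_eq X R w w"
| sym: "pres_eq X R u v \<Longrightarrow> pres_eq X R v u"
| trans: "pres_eq X R u v \<Longrightarrow> pres_eq X R v w \<Longrightarrow> pres_eq X R u w"
| cancel: "u \<in> gwords X \<Longrightarrow> v \<in> gwords X \<Longrightarrow> x \<in> X \<Longrightarrow>
    pres_eq X R (u @ [(x, b), (x, \<not> b)] @ v) (u @ v)"
| relation: "u \<in> gwords X \<Longrightarrow> v \<in> gwords X \<Longrightarrow> (l, r) \<in> R \<Longrightarrow> l \<in> gwords X \<Longrightarrow> r \<in> gwords X \<Longrightarrow>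
    pres_eq X R (u @ l @ v) (u @ r @ v)"

definition pres_class :: "'x set \<Rightarrow> ('x gword \<times> 'x gword) set \<Rightarrow> 'x gword \<Rightarrow> 'x gword set" where
  "pres_class X R w = {v. pres_eq X R w v}"

definition presented_group ::
    "'x set \<Rightarrow> ('x gword \<times> 'x gword) set \<Rightarrow> 'x gword set monoid" where
  "presented_group X R =
    \<lparr>carrier = pres_class X R ` gwords X,
     monoid.mult = (\<lambda>A B. {w. \<exists>u\<in>A. \<exists>v\<in>B. pres_eq X R (u @ v) w}),
     one = pres_class X R []\<rparr>"

definition eval_gword :: "('h, 'm) monoid_scheme \<Rightarrow> ('x \<Rightarrow> 'h) \<Rightarrow> 'x gword \<Rightarrow> 'h" where
  "eval_gword H f w =
    foldr (\<lambda>(x, b) a. (if b then f x else inv\<^bsub>H\<^esub> (f x)) \<otimes>\<^bsub>H\<^esub> a) w \<one>\<^bsub>H\<^esub>"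

text \<open>The homomorphism out of a presented group induced by a map on generators; it is
  meaningful when that map respects the relations (see \<open>pres_lift_hom\<close> below).\<close>

definition pres_lift :: "('h, 'm) monoid_scheme \<Rightarrow> ('x \<Rightarrow> 'h) \<Rightarrow> 'x gword set \<Rightarrow> 'h" where
  "pres_lift H f A = the_elem (eval_gword H f ` A)"

definition normal_closure_of :: "('a, 'b) monoid_scheme \<Rightarrow> 'a set \<Rightarrow> 'a set" where
  "normal_closure_of G S =
    generate G {g \<otimes>\<^bsub>G\<^esub> s \<otimes>\<^bsub>G\<^esub> inv\<^bsub>G\<^esub> g | g s. g \<in> carrier G \<and> s \<in> S}"

section \<open>The non-abelian tensor and exterior products\<close>

definition conj_act :: "('a, 'b) monoid_scheme \<Rightarrow> 'a \<Rightarrow> 'a \<Rightarrow> 'a" where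
  "conj_act G x y = x \<otimes>\<^bsub>G\<^esub> y \<otimes>\<^bsub>G\<^esub> inv\<^bsub>G\<^esub> x"

definition group_commutator :: "('a, 'b) monoid_scheme \<Rightarrow> 'a \<Rightarrow> 'a \<Rightarrow> 'a" where
  "group_commutator G g n = g \<otimes>\<^bsub>G\<^esub> n \<otimes>\<^bsub>G\<^esub> inv\<^bsub>G\<^esub> g \<otimes>\<^bsub>G\<^esub> inv\<^bsub>G\<^esub> n"

definition tensor_relations ::
    "('a, 'b) monoid_scheme \<Rightarrow> 'a set \<Rightarrow> (('a \<times> 'a) gword \<times> ('a \<times> 'a) gword) set" where
  "tensor_relations G N =
    {([((g \<otimes>\<^bsub>G\<^esub> g', n), True)],
      [((conj_act G g g', conj_act G g n), True), ((g, n), True)])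
      | g g' n. g \<in> carrier G \<and> g' \<in> carrier G \<and> n \<in> N} \<union>
    {([((g, n \<otimes>\<^bsub>G\<^esub> n'), True)],
      [((g, n), True), ((conj_act G n g, conj_act G n n'), True)])
      | g n n'. g \<in> carrier G \<and> n \<in> N \<and> n' \<in> N}"

definition tensor_product ::
    "('a, 'b) monoid_scheme \<Rightarrow> 'a set \<Rightarrow> ('a \<times> 'a) gword set monoid" where
  "tensor_product G N = presented_group (carrier G \<times> N) (tensor_relations G N)"

definition tensor :: "('a, 'b) monoid_scheme \<Rightarrow> 'a set \<Rightarrow> 'a \<Rightarrow> 'a \<Rightarrow> ('a \<times> 'a) gword set" where
  "tensor G N g n = pres_class (carrier G \<times> N) (tensor_relations G N) [((g, n), True)]"

definition tensor_diagonal :: "('a, 'b) monoid_scheme \<Rightarrow> 'a set \<Rightarrow> ('a \<times> 'a) gword set set" where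
  "tensor_diagonal G N = normal_closure_of (tensor_product G N) {tensor G N x x | x. x \<in> N}"

definition exterior_product ::
    "('a, 'b) monoid_scheme \<Rightarrow> 'a set \<Rightarrow> ('a \<times> 'a) gword set set monoid" where
  "exterior_product G N = tensor_product G N Mod tensor_diagonal G N"

definition wedge ::
    "('a, 'b) monoid_scheme \<Rightarrow> 'a set \<Rightarrow> 'a \<Rightarrow> 'a \<Rightarrow> ('a \<times> 'a) gword set set" where
  "wedge G N g n = tensor_diagonal G N #>\<^bsub>tensor_product G N\<^esub> tensor G N g n"

section \<open>The Schur multiplier of a pair\<close>

definition commutator_subgroup :: "('a, 'b) monoid_scheme \<Rightarrow> 'a set \<Rightarrow> 'a set" where
  "commutator_subgroup G N =
    generate G {group_commutator G g n | g n. g \<in> carrier G \<and> n \<in> N}"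

text \<open>The commutator map is first induced on the tensor product by its values on generators and
  then passed to the quotient; \<open>kappa_hom\<close> and \<open>kappa_wedge\<close> below confirm that this is the
  homomorphism sending \<open>g \<and> n\<close> to \<open>[g, n]\<close>.\<close>

definition kappa :: "('a, 'b) monoid_scheme \<Rightarrow> 'a set \<Rightarrow> ('a \<times> 'a) gword set set \<Rightarrow> 'a" where
  "kappa G N C = the_elem (pres_lift G (\<lambda>(g, n). group_commutator G g n) ` C)"

definition schur_multiplier ::
    "('a, 'b) monoid_scheme \<Rightarrow> 'a set \<Rightarrow> ('a \<times> 'a) gword set set set" where
  "schur_multiplier G N =
    kernel (exterior_product G N) (G\<lparr>carrier := commutator_subgroup G N\<rparr>) (kappa G N)"

section \<open>Degrees and centres\<close>

definition exterior_degree :: "('a, 'b) monoid_scheme \<Rightarrow> 'a set \<Rightarrow> real" where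
  "exterior_degree G N =
    real (card {(g, n) \<in> carrier G \<times> N. wedge G N g n = \<one>\<^bsub>exterior_product G N\<^esub>}) /
    (real (card (carrier G)) * real (card N))"

definition relative_commutativity_degree :: "('a, 'b) monoid_scheme \<Rightarrow> 'a set \<Rightarrow> real" where
  "relative_commutativity_degree G N =
    real (card {(x, y) \<in> carrier G \<times> N. x \<otimes>\<^bsub>G\<^esub> y = y \<otimes>\<^bsub>G\<^esub> x}) /
    (real (card (carrier G)) * real (card N))"

definition exterior_centre :: "('a, 'b) monoid_scheme \<Rightarrow> 'a set \<Rightarrow> 'a set" where
  "exterior_centre G N =
    {n \<in> N. \<forall>g\<in>carrier G. wedge G N g n = \<one>\<^bsub>exterior_product G N\<^esub>}"

definition relative_centre :: "('a, 'b) monoid_scheme \<Rightarrow> 'a set \<Rightarrow> 'a set" where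
  "relative_centre G N = {n \<in> N. \<forall>g\<in>carrier G. g \<otimes>\<^bsub>G\<^esub> n \<otimes>\<^bsub>G\<^esub> inv\<^bsub>G\<^esub> g = n}"

section \<open>The constructions are well defined\<close>

lemma gwords_simps [simp]:
  "[] \<in> gwords X"
  "a # w \<in> gwords X \<longleftrightarrow> fst a \<in> X \<and> w \<in> gwords X"
  "u @ v \<in> gwords X \<longleftrightarrow> u \<in> gwords X \<and> v \<in> gwords X"
  by (auto simp: gwords_def mem_Times_iff)

lemma pres_eq_gwords: "pres_eq X R u v \<Longrightarrow> u \<in> gwords X \<and> v \<in> gwords X"
  by (induction rule: pres_eq.induct) auto

lemma pres_eq_context:
  assumes "pres_eq X R u v" "a \<in> gwords X" "b \<in> gwords X"
  shows "pres_eq X R (a @ u @ b) (a @ v @ b)"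
  using assms
proof (induction rule: pres_eq.induct)
  case (refl w)
  then show ?case by (intro pres_eq.refl) auto
next
  case (sym u v)
  then show ?case by (blast intro: pres_eq.sym)
next
  case (trans u v w)
  then show ?case by (blast intro: pres_eq.trans)
next
  case (cancel u v x c)
  then show ?case using pres_eq.cancel[of "a @ u" X "v @ b" x R c] by simp
next
  case (relation u v l r)
  then show ?case using pres_eq.relation[of "a @ u" X "v @ b" l r R] by simp
qed

lemma pres_eq_append:
  assumes "pres_eq X R u u'" "pres_eq X R v v'"
  shows "pres_eq X R (u @ v) (u' @ v')"
  using pres_eq_context[OF assms(1), of "[]" v] pres_eq_context[OF assms(2), of u' "[]"]
    pres_eq_gwords[OF assms(1)] pres_eq_gwords[OF assms(2)]
  by (auto intro: pres_eq.trans)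

lemma pres_class_eq_iff:
  assumes "u \<in> gwords X"
  shows "pres_class X R u = pres_class X R v \<longleftrightarrow> pres_eq X R u v"
  using assms unfolding pres_class_def
  by (blast intro: pres_eq.refl pres_eq.sym pres_eq.trans)

lemma pres_mult:
  assumes "u \<in> gwords X" "v \<in> gwords X"
  shows "pres_class X R u \<otimes>\<^bsub>presented_group X R\<^esub> pres_class X R v = pres_class X R (u @ v)"
proof -
  have "(\<exists>u'. pres_eq X R u u' \<and> (\<exists>v'. pres_eq X R v v' \<and> pres_eq X R (u' @ v') w))
      \<longleftrightarrow> pres_eq X R (u @ v) w" for w
    using assms by (meson pres_eq.refl pres_eq.trans pres_eq_append)
  then show ?thesis by (auto simp: presented_group_def pres_class_def)
qed

definition inv_gword :: "'x gword \<Rightarrow> 'x gword" where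
  "inv_gword w = rev (map (\<lambda>(x, b). (x, \<not> b)) w)"

lemma inv_gword_gwords [simp]: "inv_gword w \<in> gwords X \<longleftrightarrow> w \<in> gwords X"
  by (induction w) (auto simp: inv_gword_def)

lemma inv_gword_left: "w \<in> gwords X \<Longrightarrow> pres_eq X R (inv_gword w @ w) []"
proof (induction w)
  case Nil
  then show ?case by (simp add: inv_gword_def pres_eq.refl)
next
  case (Cons a w)
  obtain x b where a: "a = (x, b)" by force
  have "pres_eq X R (inv_gword w @ [(x, \<not> b), (x, \<not> \<not> b)] @ w) (inv_gword w @ w)"
    using Cons.prems a by (intro pres_eq.cancel) auto
  then show ?case
    using Cons a by (auto simp: inv_gword_def intro: pres_eq.trans)
qed

lemma carrier_presented [simp]: "carrier (presented_group X R) = pres_class X R ` gwords X"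
  by (simp add: presented_group_def)

lemma one_presented: "\<one>\<^bsub>presented_group X R\<^esub> = pres_class X R []"
  by (simp add: presented_group_def)

lemma group_presented_group: "group (presented_group X R)"
proof (rule groupI)
  fix x y
  assume "x \<in> carrier (presented_group X R)" "y \<in> carrier (presented_group X R)"
  then show "x \<otimes>\<^bsub>presented_group X R\<^esub> y \<in> carrier (presented_group X R)"
    by (auto simp: pres_mult)
next
  show "\<one>\<^bsub>presented_group X R\<^esub> \<in> carrier (presented_group X R)"
    by (auto simp: one_presented)
next
  fix x y z
  assume "x \<in> carrier (presented_group X R)" "y \<in> carrier (presented_group X R)"
    "z \<in> carrier (presented_group X R)"
  then show "x \<otimes>\<^bsub>presented_group X R\<^esub> y \<otimes>\<^bsub>presented_group X R\<^esub> z =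
      x \<otimes>\<^bsub>presented_group X R\<^esub> (y \<otimes>\<^bsub>presented_group X R\<^esub> z)"
    by (auto simp: pres_mult)
next
  fix x
  assume x: "x \<in> carrier (presented_group X R)"
  then show "\<one>\<^bsub>presented_group X R\<^esub> \<otimes>\<^bsub>presented_group X R\<^esub> x = x"
    by (auto simp: pres_mult one_presented)
  from x obtain w where w: "w \<in> gwords X" "x = pres_class X R w" by auto
  then have "pres_class X R (inv_gword w) \<otimes>\<^bsub>presented_group X R\<^esub> x = \<one>\<^bsub>presented_group X R\<^esub>"
    by (simp add: pres_mult one_presented pres_class_eq_iff inv_gword_left)
  with w show "\<exists>y\<in>carrier (presented_group X R).
      y \<otimes>\<^bsub>presented_group X R\<^esub> x = \<one>\<^bsub>presented_group X R\<^esub>"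
    by (intro bexI[of _ "pres_class X R (inv_gword w)"]) auto
qed

context group
begin

lemma eval_gword_closed [simp]:
  assumes "f ` X \<subseteq> carrier G" "w \<in> gwords X"
  shows "eval_gword G f w \<in> carrier G"
  using assms(2) by (induction w) (use assms(1) in \<open>auto simp: eval_gword_def\<close>)

lemma eval_gword_append:
  assumes f: "f ` X \<subseteq> carrier G" and "u \<in> gwords X" and v: "v \<in> gwords X"
  shows "eval_gword G f (u @ v) = eval_gword G f u \<otimes> eval_gword G f v"
  using assms(2)
proof (induction u)
  case Nil
  then show ?case using f v by (simp add: eval_gword_def eval_gword_closed[unfolded eval_gword_def])
next
  case (Cons a u)
  obtain x b where a: "a = (x, b)" by force
  have step: "eval_gword G f ((x, b) # w) = (if b then f x else inv f x) \<otimes> eval_gword G f w" for w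
    by (simp add: eval_gword_def)
  have "f x \<in> carrier G" using Cons.prems f a by auto
  with Cons f v show ?case by (auto simp: a step m_assoc)
qed

lemma eval_gword_pres_eq:
  assumes f: "f ` X \<subseteq> carrier G"
    and R: "\<And>l r. (l, r) \<in> R \<Longrightarrow> eval_gword G f l = eval_gword G f r"
    and eq: "pres_eq X R u v"
  shows "eval_gword G f u = eval_gword G f v"
  using eq
proof (induction rule: pres_eq.induct)
  case (cancel u v x b)
  then have x: "f x \<in> carrier G" using f by auto
  then have "eval_gword G f [(x, b), (x, \<not> b)] = \<one>"
    by (auto simp: eval_gword_def)
  with cancel f show ?case
    by (simp add: eval_gword_append[OF f] del: append_Cons append_Nil)
next
  case (relation u v l r)
  with f R show ?case by (simp add: eval_gword_append[OF f])
qed auto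

lemma pres_lift_class:
  assumes f: "f ` X \<subseteq> carrier G"
    and R: "\<And>l r. (l, r) \<in> R \<Longrightarrow> eval_gword G f l = eval_gword G f r"
    and w: "w \<in> gwords X"
  shows "pres_lift G f (pres_class X R w) = eval_gword G f w"
proof -
  have "eval_gword G f ` pres_class X R w = {eval_gword G f w}"
    using eval_gword_pres_eq[OF f R] pres_eq.refl[OF w]
    by (fastforce simp: pres_class_def)
  then show ?thesis by (simp add: pres_lift_def)
qed

lemma pres_lift_hom:
  assumes f: "f ` X \<subseteq> carrier G"
    and R: "\<And>l r. (l, r) \<in> R \<Longrightarrow> eval_gword G f l = eval_gword G f r"
  shows "pres_lift G f \<in> hom (presented_group X R) G"
proof (rule homI)
  fix x assume "x \<in> carrier (presented_group X R)"
  then show "pres_lift G f x \<in> carrier G" using f by (auto simp: pres_lift_class[OF f R])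
next
  fix x y assume "x \<in> carrier (presented_group X R)" "y \<in> carrier (presented_group X R)"
  then show "pres_lift G f (x \<otimes>\<^bsub>presented_group X R\<^esub> y) = pres_lift G f x \<otimes> pres_lift G f y"
    using f by (auto simp: pres_mult pres_lift_class[OF f R] eval_gword_append[OF f])
qed

lemma normal_closure_of_normal:
  assumes S: "S \<subseteq> carrier G"
  shows "normal_closure_of G S \<lhd> G"
  unfolding normal_closure_of_def
proof (rule normal_generateI)
  show "{g \<otimes> s \<otimes> inv g |g s. g \<in> carrier G \<and> s \<in> S} \<subseteq> carrier G" using S by auto
next
  fix h g
  assume h: "h \<in> {g \<otimes> s \<otimes> inv g |g s. g \<in> carrier G \<and> s \<in> S}" and g: "g \<in> carrier G"
  then obtain k s where ks: "h = k \<otimes> s \<otimes> inv k" "k \<in> carrier G" "s \<in> S" by auto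
  with S g have "g \<otimes> h \<otimes> inv g = (g \<otimes> k) \<otimes> s \<otimes> inv (g \<otimes> k)"
    by (auto simp: m_assoc inv_mult_group subset_iff)
  with ks g show "g \<otimes> h \<otimes> inv g \<in> {g \<otimes> s \<otimes> inv g |g s. g \<in> carrier G \<and> s \<in> S}"
    by blast
qed

lemma normal_closure_of_subset:
  assumes S: "S \<subseteq> carrier G"
  shows "S \<subseteq> normal_closure_of G S"
proof
  fix s assume s: "s \<in> S"
  then have "s = \<one> \<otimes> s \<otimes> inv \<one>" using S by auto
  with s show "s \<in> normal_closure_of G S"
    unfolding normal_closure_of_def by (intro generate.incl) blast
qed

lemma normal_closure_of_minimal:
  assumes "S \<subseteq> M" "M \<lhd> G"
  shows "normal_closure_of G S \<subseteq> M"
proof -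
  interpret M: normal M G by fact
  show ?thesis
    unfolding normal_closure_of_def
    using assms(1) by (intro generate_subgroup_incl M.subgroup_axioms) (auto intro: M.inv_op_closed2)
qed

end

lemma (in group) inv_cancel:
  assumes "x \<in> carrier G" "y \<in> carrier G"
  shows "x \<otimes> (inv x \<otimes> y) = y" "inv x \<otimes> (x \<otimes> y) = y"
  using assms by (simp_all flip: m_assoc)

context normal
begin

lemma tensor_map_relations:
  assumes "(l, r) \<in> tensor_relations G H"
  shows "eval_gword G (\<lambda>(g, n). group_commutator G g n) l =
    eval_gword G (\<lambda>(g, n). group_commutator G g n) r"
  using assms
  by (auto simp: tensor_relations_def eval_gword_def group_commutator_def conj_act_def
      m_assoc inv_mult_group mem_carrier inv_cancel)

lemma tensor_map_closed:
  "(\<lambda>(g, n). group_commutator G g n) ` (carrier G \<times> H) \<subseteq> carrier G"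
  by (auto simp: group_commutator_def mem_carrier)

abbreviation "tensor_map \<equiv> pres_lift G (\<lambda>(g, n). group_commutator G g n)"

lemma tensor_map_tensor:
  assumes "g \<in> carrier G" "n \<in> H"
  shows "tensor_map (tensor G H g n) = group_commutator G g n"
proof -
  have "[((g, n), True)] \<in> gwords (carrier G \<times> H)" using assms by simp
  then show ?thesis
    using assms pres_lift_class[OF tensor_map_closed tensor_map_relations]
    by (simp add: tensor_def eval_gword_def group_commutator_def mem_carrier)
qed

lemma tensor_map_group_hom: "group_hom (tensor_product G H) G tensor_map"
  unfolding tensor_product_def
  by (intro group_hom.intro group_hom_axioms.intro group_presented_group is_group
      pres_lift_hom[OF tensor_map_closed tensor_map_relations])

lemma tensor_closed [simp]:
  assumes "g \<in> carrier G" "n \<in> H"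
  shows "tensor G H g n \<in> carrier (tensor_product G H)"
  using assms by (auto simp: tensor_def tensor_product_def)

lemma tensor_product_relations:
  assumes "g \<in> carrier G" "n \<in> H"
  shows "g' \<in> carrier G \<Longrightarrow> tensor G H (g \<otimes> g') n =
      tensor G H (conj_act G g g') (conj_act G g n) \<otimes>\<^bsub>tensor_product G H\<^esub> tensor G H g n"
    and "n' \<in> H \<Longrightarrow> tensor G H g (n \<otimes> n') =
      tensor G H g n \<otimes>\<^bsub>tensor_product G H\<^esub> tensor G H (conj_act G n g) (conj_act G n n')"
proof -
  let ?X = "carrier G \<times> H" and ?R = "tensor_relations G H"
  have rel: "pres_eq ?X ?R l r"
    if "(l, r) \<in> ?R" "l \<in> gwords ?X" "r \<in> gwords ?X" for l r
    using pres_eq.relation[of "[]" ?X "[]" l r ?R] that by simp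
  have conj_H: "conj_act G x y \<in> H" if "x \<in> carrier G" "y \<in> H" for x y
    using that by (simp add: conj_act_def inv_op_closed2)
  have conj_G: "conj_act G x y \<in> carrier G" if "x \<in> carrier G" "y \<in> carrier G" for x y
    using that by (simp add: conj_act_def)
  show "tensor G H (g \<otimes> g') n =
      tensor G H (conj_act G g g') (conj_act G g n) \<otimes>\<^bsub>tensor_product G H\<^esub> tensor G H g n"
    if "g' \<in> carrier G"
    using assms that unfolding tensor_def tensor_product_def
    by (simp add: pres_mult conj_H conj_G pres_class_eq_iff, intro rel)
      (auto simp: tensor_relations_def conj_H conj_G)
  show "tensor G H g (n \<otimes> n') =
      tensor G H g n \<otimes>\<^bsub>tensor_product G H\<^esub> tensor G H (conj_act G n g) (conj_act G n n')"
    if "n' \<in> H"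
    using assms that unfolding tensor_def tensor_product_def
    by (simp add: pres_mult conj_H conj_G mem_carrier pres_class_eq_iff, intro rel)
      (auto simp: tensor_relations_def conj_H conj_G mem_carrier)
qed

lemma tensor_diagonal_normal: "tensor_diagonal G H \<lhd> tensor_product G H"
  and tensor_diagonal_incl: "x \<in> H \<Longrightarrow> tensor G H x x \<in> tensor_diagonal G H"
proof -
  interpret T: group "tensor_product G H"
    unfolding tensor_product_def by (rule group_presented_group)
  have sub: "{tensor G H x x |x. x \<in> H} \<subseteq> carrier (tensor_product G H)"
    by (auto intro: tensor_closed simp: mem_carrier)
  show "tensor_diagonal G H \<lhd> tensor_product G H"
    unfolding tensor_diagonal_def by (rule T.normal_closure_of_normal[OF sub])
  show "tensor G H x x \<in> tensor_diagonal G H" if "x \<in> H"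
    unfolding tensor_diagonal_def using T.normal_closure_of_subset[OF sub] that by auto
qed

lemma group_exterior_product: "group (exterior_product G H)"
  unfolding exterior_product_def
  by (rule normal.factorgroup_is_group[OF tensor_diagonal_normal])

lemma wedge_closed:
  assumes "g \<in> carrier G" "n \<in> H"
  shows "wedge G H g n \<in> carrier (exterior_product G H)"
  using tensor_closed[OF assms]
  by (auto simp: wedge_def exterior_product_def FactGroup_def RCOSETS_def)

lemma wedge_self:
  assumes "x \<in> H"
  shows "wedge G H x x = \<one>\<^bsub>exterior_product G H\<^esub>"
proof -
  interpret D: normal "tensor_diagonal G H" "tensor_product G H" by (rule tensor_diagonal_normal)
  show ?thesis
    using D.rcos_const[OF D.is_group tensor_diagonal_incl[OF assms]]
    by (simp add: wedge_def exterior_product_def FactGroup_def)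
qed

lemma tensor_map_kernel: "tensor_diagonal G H \<subseteq> kernel (tensor_product G H) G tensor_map"
proof -
  interpret h: group_hom "tensor_product G H" G tensor_map by (rule tensor_map_group_hom)
  show ?thesis
    unfolding tensor_diagonal_def
  proof (rule h.normal_closure_of_minimal[OF _ h.normal_kernel])
    show "{tensor G H x x |x. x \<in> H} \<subseteq> kernel (tensor_product G H) G tensor_map"
      by (auto simp: kernel_def tensor_map_tensor mem_carrier)
        (simp add: group_commutator_def m_assoc mem_carrier inv_cancel)
  qed
qed

lemma kappa_coset:
  assumes "t \<in> carrier (tensor_product G H)"
  shows "kappa G H (tensor_diagonal G H #>\<^bsub>tensor_product G H\<^esub> t) = tensor_map t"
proof -
  interpret h: group_hom "tensor_product G H" G tensor_map by (rule tensor_map_group_hom)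
  interpret D: normal "tensor_diagonal G H" "tensor_product G H" by (rule tensor_diagonal_normal)
  have "tensor_map (d \<otimes>\<^bsub>tensor_product G H\<^esub> t) = tensor_map t" if "d \<in> tensor_diagonal G H" for d
    using that assms tensor_map_kernel D.mem_carrier by (auto simp: kernel_def)
  moreover have "tensor_diagonal G H \<noteq> {}" using D.subgroup_axioms subgroup.one_closed by blast
  ultimately have "tensor_map ` (tensor_diagonal G H #>\<^bsub>tensor_product G H\<^esub> t) = {tensor_map t}"
    by (auto simp: r_coset_def image_iff)
  then show ?thesis by (simp add: kappa_def)
qed

lemma kappa_wedge:
  assumes "g \<in> carrier G" "n \<in> H"
  shows "kappa G H (wedge G H g n) = group_commutator G g n"
  using assms by (simp add: wedge_def kappa_coset tensor_map_tensor)

lemma tensor_map_in_commutator_subgroup: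
  assumes "t \<in> carrier (tensor_product G H)"
  shows "tensor_map t \<in> commutator_subgroup G H"
proof -
  let ?f = "\<lambda>(g, n). group_commutator G g n"
  have "subgroup (commutator_subgroup G H) G"
    unfolding commutator_subgroup_def
    by (rule generate_is_subgroup) (auto simp: group_commutator_def mem_carrier)
  then interpret C: subgroup "commutator_subgroup G H" G .
  obtain w where w: "w \<in> gwords (carrier G \<times> H)"
    "t = pres_class (carrier G \<times> H) (tensor_relations G H) w"
    using assms by (auto simp: tensor_product_def)
  have gen: "group_commutator G g n \<in> commutator_subgroup G H"
    if "g \<in> carrier G" "n \<in> H" for g n
    unfolding commutator_subgroup_def using that by (intro generate.incl) blast
  from w(1) have "eval_gword G ?f w \<in> commutator_subgroup G H"
    by (induction w) (auto simp: eval_gword_def intro!: C.m_closed C.m_inv_closed gen)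
  then show ?thesis
    using w pres_lift_class[OF tensor_map_closed tensor_map_relations] by simp
qed

lemma kappa_hom:
  "kappa G H \<in> hom (exterior_product G H) (G\<lparr>carrier := commutator_subgroup G H\<rparr>)"
proof (rule homI)
  interpret h: group_hom "tensor_product G H" G tensor_map by (rule tensor_map_group_hom)
  interpret D: normal "tensor_diagonal G H" "tensor_product G H" by (rule tensor_diagonal_normal)
  fix x assume "x \<in> carrier (exterior_product G H)"
  then obtain s where s: "s \<in> carrier (tensor_product G H)"
    "x = tensor_diagonal G H #>\<^bsub>tensor_product G H\<^esub> s"
    by (auto simp: exterior_product_def FactGroup_def RCOSETS_def)
  then show "kappa G H x \<in> carrier (G\<lparr>carrier := commutator_subgroup G H\<rparr>)"
    by (simp add: kappa_coset tensor_map_in_commutator_subgroup)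
  fix y assume "y \<in> carrier (exterior_product G H)"
  then obtain t where t: "t \<in> carrier (tensor_product G H)"
    "y = tensor_diagonal G H #>\<^bsub>tensor_product G H\<^esub> t"
    by (auto simp: exterior_product_def FactGroup_def RCOSETS_def)
  have "x \<otimes>\<^bsub>exterior_product G H\<^esub> y =
      tensor_diagonal G H #>\<^bsub>tensor_product G H\<^esub> (s \<otimes>\<^bsub>tensor_product G H\<^esub> t)"
    using s t by (simp add: exterior_product_def FactGroup_def D.rcos_sum)
  with s t show "kappa G H (x \<otimes>\<^bsub>exterior_product G H\<^esub> y) =
      kappa G H x \<otimes>\<^bsub>G\<lparr>carrier := commutator_subgroup G H\<rparr>\<^esub> kappa G H y"
    by (simp add: kappa_coset)
qed

end

end

theory Submission
  imports Defs
begin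

text \<open>
  If \<open>g\<close> commutes with \<open>n\<close>, substituting \<open>g' = g\<inverse>hg\<close> into the first tensor relation
  gives \<open>hg \<and> n = (h \<and> n)(g \<and> n)\<close>. Hence \<open>g \<mapsto> g \<and> n\<close> is a homomorphism from the centraliser
  \<open>C(n)\<close> into \<open>M(G,N)\<close>, whose kernel is the exterior centraliser \<open>C\<^sup>\<and>(n) = {g. g \<and> n = 1}\<close>.
  Therefore \<open>|C(n)| \<le> |M(G,N)| |C\<^sup>\<and>(n)|\<close>, and \<open>C\<^sup>\<and>(n)\<close> is a subgroup of \<open>G\<close>, of index at least
  \<open>p\<close> if it is proper. Both bounds follow by summing over \<open>n\<close>, treating the \<open>n\<close> in the exterior
  centre (for (i)), respectively in the centre but not in the exterior centre (for (ii)), separately.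
  No finiteness of \<open>M(G,N)\<close> is needed: if it were infinite, \<open>card\<close> and \<open>1 / 0\<close> would both be \<open>0\<close> and
  (i) would reduce to the contribution of the exterior centre.
\<close>

section \<open>Counting pairs, homomorphic images and proper subgroups\<close>

lemma card_pairs_eq_sum_fibres:
  assumes "finite A" "finite B"
  shows "card {(a, b) \<in> A \<times> B. P a b} = (\<Sum>b\<in>B. card {a \<in> A. P a b})"
proof -
  have "bij_betw prod.swap (SIGMA b:B. {a \<in> A. P a b}) {(a, b) \<in> A \<times> B. P a b}"
    by (rule bij_betwI[where g = prod.swap]) auto
  then have "card {(a, b) \<in> A \<times> B. P a b} = card (SIGMA b:B. {a \<in> A. P a b})"
    by (simp add: bij_betw_same_card)
  then show ?thesis using assms by simp
qed

text \<open>First isomorphism theorem combined with Lagrange: the cosets of the kernel correspond to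
  the elements of the image.\<close>

lemma (in group_hom) card_image_kernel:
  "card (h ` carrier G) * card (kernel G H h) = order G"
proof -
  \<comment> \<open>Shrinking the codomain to the image makes \<open>h\<close> surjective, as the
    isomorphism theorem requires.\<close>
  let ?I = "H\<lparr>carrier := h ` carrier G\<rparr>"
  have "group ?I"
    using img_is_subgroup H.is_group by (rule subgroup.subgroup_is_group)
  then have "group_hom G ?I h"
    by (intro group_hom.intro group_hom_axioms.intro G.is_group) (auto simp: hom_def)
  then have "(\<lambda>X. the_elem (h ` X)) \<in> iso (G Mod kernel G ?I h) ?I"
    by (rule group_hom.FactGroup_iso_set) simp
  then have "bij_betw (\<lambda>X. the_elem (h ` X)) (carrier (G Mod kernel G H h)) (h ` carrier G)"
    by (simp add: iso_def kernel_def)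
  then have "card (rcosets\<^bsub>G\<^esub> kernel G H h) = card (h ` carrier G)"
    by (simp add: bij_betw_same_card FactGroup_def)
  then show ?thesis using G.lagrange[OF subgroup_kernel] by simp
qed

text \<open>The index exceeds 1 and divides the order, so it has a prime factor, which is at least
  \<open>p\<close> by minimality.\<close>

lemma (in group) proper_subgroup_card_le:
  assumes fin: "finite (carrier G)" and H: "subgroup H G" and proper: "H \<noteq> carrier G"
    and least: "\<And>q. prime q \<Longrightarrow> q dvd order G \<Longrightarrow> p \<le> q"
  shows "p * card H \<le> order G"
proof -
  let ?k = "card (rcosets H)"
  have lag: "?k * card H = order G" using lagrange[OF H] .
  have "H \<subseteq> carrier G" using H by (rule subgroup.subset)
  then have "card H < order G"
    unfolding order_def using fin proper by (intro psubset_card_mono) auto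
  then have "?k \<noteq> 0" "?k \<noteq> 1" using lag by (metis less_zeroE mult_0, metis less_irrefl mult_1)
  then obtain q where q: "prime q" "q dvd ?k" using prime_factor_nat by blast
  then have "p \<le> q" using least lag by (metis dvd_mult2)
  also have "q \<le> ?k" using q \<open>?k \<noteq> 0\<close> by (simp add: dvd_imp_le)
  finally show ?thesis using lag by (metis mult_le_mono1)
qed

section \<open>Centralisers and exterior centralisers\<close>

context normal
begin

definition centraliser :: "'a \<Rightarrow> 'a set" where
  "centraliser n = {g \<in> carrier G. g \<otimes> n = n \<otimes> g}"

definition exterior_centraliser :: "'a \<Rightarrow> 'a set" where
  "exterior_centraliser n = {g \<in> carrier G. wedge G H g n = \<one>\<^bsub>exterior_product G H\<^esub>}"

lemma group_commutator_eq_one_iff: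
  assumes "g \<in> carrier G" "n \<in> carrier G"
  shows "group_commutator G g n = \<one> \<longleftrightarrow> g \<otimes> n = n \<otimes> g"
proof -
  have "group_commutator G g n = (g \<otimes> n) \<otimes> inv (n \<otimes> g)"
    using assms by (simp add: group_commutator_def m_assoc inv_mult_group)
  then show ?thesis using assms
    by (metis inv_closed inv_inv m_closed inv_equality r_inv)
qed

lemma conj_eq_iff_commute:
  assumes "g \<in> carrier G" "n \<in> carrier G"
  shows "g \<otimes> n \<otimes> inv g = n \<longleftrightarrow> g \<otimes> n = n \<otimes> g"
  using assms by (metis inv_solve_right m_closed)

text \<open>The identity is the diagonal symbol \<open>wedge G H \<one> \<one>\<close>, whose image
  is the commutator of \<open>\<one>\<close> with itself.\<close>

lemma kappa_one: "kappa G H \<one>\<^bsub>exterior_product G H\<^esub> = \<one>"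
  using kappa_wedge[of \<one> \<one>] wedge_self[of \<one>] by (simp add: group_commutator_def)

lemma wedge_mult_left:
  assumes g: "g \<in> centraliser n" and h: "h \<in> carrier G" and n: "n \<in> H"
  shows "wedge G H (h \<otimes> g) n = wedge G H h n \<otimes>\<^bsub>exterior_product G H\<^esub> wedge G H g n"
proof -
  interpret D: normal "tensor_diagonal G H" "tensor_product G H" by (rule tensor_diagonal_normal)
  have g': "g \<in> carrier G" "g \<otimes> n = n \<otimes> g" using g by (auto simp: centraliser_def)
  have nG: "n \<in> carrier G" using n by (rule mem_carrier)
  have "conj_act G g n = n"
    using conj_eq_iff_commute[OF g'(1) nG] g'(2) by (simp add: conj_act_def)
  moreover have "conj_act G g (inv g \<otimes> h \<otimes> g) = h" "g \<otimes> (inv g \<otimes> h \<otimes> g) = h \<otimes> g"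
    using g' h by (simp_all add: conj_act_def m_assoc inv_cancel)
  ultimately have "tensor G H (h \<otimes> g) n =
      tensor G H h n \<otimes>\<^bsub>tensor_product G H\<^esub> tensor G H g n"
    using tensor_product_relations(1)[of g n "inv g \<otimes> h \<otimes> g"] g' h n by simp
  then show ?thesis
    using g' h n by (simp add: wedge_def exterior_product_def FactGroup_def D.rcos_sum)
qed

text \<open>\<open>kappa\<close> turns a trivial wedge of \<open>g\<close> and \<open>n\<close> into
  a trivial commutator.\<close>

lemma exterior_centraliser_subset:
  assumes "n \<in> H"
  shows "exterior_centraliser n \<subseteq> centraliser n"
proof
  fix g assume "g \<in> exterior_centraliser n"
  then have g: "g \<in> carrier G" "wedge G H g n = \<one>\<^bsub>exterior_product G H\<^esub>"
    by (auto simp: exterior_centraliser_def)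
  then have "group_commutator G g n = \<one>"
    using kappa_wedge[OF g(1) assms] kappa_one by simp
  then show "g \<in> centraliser n"
    using g(1) assms by (simp add: centraliser_def group_commutator_eq_one_iff mem_carrier)
qed

lemma subgroup_centraliser:
  assumes n: "n \<in> carrier G"
  shows "subgroup (centraliser n) G"
proof (rule subgroupI)
  show "centraliser n \<noteq> {}" using n by (auto simp: centraliser_def intro!: exI[of _ \<one>])
  show "inv a \<in> centraliser n" if a: "a \<in> centraliser n" for a
  proof -
    have "a \<in> carrier G" "a \<otimes> n = n \<otimes> a" using a by (auto simp: centraliser_def)
    then have "inv a \<otimes> n = n \<otimes> inv a"
      using n by (metis inv_closed inv_solve_left inv_solve_right m_assoc m_closed)
    with \<open>a \<in> carrier G\<close> show ?thesis by (simp add: centraliser_def)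
  qed
  show "a \<otimes> b \<in> centraliser n" if ab: "a \<in> centraliser n" "b \<in> centraliser n" for a b
  proof -
    have "a \<in> carrier G" "a \<otimes> n = n \<otimes> a" "b \<in> carrier G" "b \<otimes> n = n \<otimes> b"
      using ab by (auto simp: centraliser_def)
    then have "a \<otimes> b \<otimes> n = n \<otimes> (a \<otimes> b)" using n by (metis m_assoc)
    with \<open>a \<in> carrier G\<close> \<open>b \<in> carrier G\<close> show ?thesis by (simp add: centraliser_def)
  qed
qed (auto simp: centraliser_def)

lemma wedge_group_hom:
  assumes "n \<in> H"
  shows "group_hom (G\<lparr>carrier := centraliser n\<rparr>) (exterior_product G H) (\<lambda>g. wedge G H g n)"
proof (intro group_hom.intro group_hom_axioms.intro group_exterior_product homI)
  show "group (G\<lparr>carrier := centraliser n\<rparr>)"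
    using subgroup_centraliser assms by (simp add: subgroup.subgroup_is_group mem_carrier)
qed (use assms in \<open>auto simp: wedge_closed wedge_mult_left centraliser_def\<close>)

text \<open>A priori the kernel is only the part of the exterior centraliser inside
  \<open>centraliser n\<close>; \<open>exterior_centraliser_subset\<close> shows that this is all of
  it.\<close>

lemma kernel_wedge:
  assumes "n \<in> H"
  shows "kernel (G\<lparr>carrier := centraliser n\<rparr>) (exterior_product G H) (\<lambda>g. wedge G H g n) =
    exterior_centraliser n"
  using exterior_centraliser_subset[OF assms]
  by (auto simp: kernel_def exterior_centraliser_def centraliser_def)

lemma subgroup_exterior_centraliser:
  assumes "n \<in> H"
  shows "subgroup (exterior_centraliser n) G"
  using incl_subgroup[OF subgroup_centraliser[OF mem_carrier[OF assms]]]
    group_hom.subgroup_kernel[OF wedge_group_hom[OF assms]] by (simp add: kernel_wedge[OF assms])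

lemma wedge_in_schur_multiplier:
  assumes "n \<in> H" "g \<in> centraliser n"
  shows "wedge G H g n \<in> schur_multiplier G H"
  using assms kappa_wedge[of g n] wedge_closed[of g n]
  by (auto simp: schur_multiplier_def kernel_def centraliser_def group_commutator_eq_one_iff mem_carrier)

text \<open>The centraliser has image size times kernel size many elements, and the image lies in
  the multiplier. Finiteness lets this inclusion pass to cardinalities, as \<open>card\<close> is 0
  on infinite sets.\<close>

lemma card_centraliser_le:
  assumes "n \<in> H" and fin: "finite (schur_multiplier G H)"
  shows "card (centraliser n) \<le> card (schur_multiplier G H) * card (exterior_centraliser n)"
proof -
  have "card (centraliser n) =
      card ((\<lambda>g. wedge G H g n) ` centraliser n) * card (exterior_centraliser n)"
    using group_hom.card_image_kernel[OF wedge_group_hom[OF assms(1)]]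
    by (simp add: kernel_wedge[OF assms(1)] order_def)
  also have "\<dots> \<le> card (schur_multiplier G H) * card (exterior_centraliser n)"
    using wedge_in_schur_multiplier[OF assms(1)] fin by (intro mult_right_mono card_mono) auto
  finally show ?thesis .
qed

text \<open>Prepares the case splits of the pointwise estimates, which ask whether a centraliser is
  the whole group.\<close>

lemma exterior_centre_iff:
  "n \<in> exterior_centre G H \<longleftrightarrow> n \<in> H \<and> exterior_centraliser n = carrier G"
  by (auto simp: exterior_centre_def exterior_centraliser_def)

lemma relative_centre_iff:
  "n \<in> relative_centre G H \<longleftrightarrow> n \<in> H \<and> centraliser n = carrier G"
  by (auto simp: relative_centre_def centraliser_def conj_eq_iff_commute mem_carrier)

lemma exterior_centre_subset: "exterior_centre G H \<subseteq> relative_centre G H"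
  using exterior_centraliser_subset
  by (auto simp: exterior_centre_iff relative_centre_iff) (auto simp: centraliser_def)

section \<open>Degrees as sums over the normal subgroup, and the two bounds\<close>

lemma exterior_degree_eq_sum:
  assumes "finite (carrier G)"
  shows "exterior_degree G H =
    (\<Sum>n\<in>H. real (card (exterior_centraliser n))) / (real (order G) * real (card H))"
  using card_pairs_eq_sum_fibres[OF assms finite_subset[OF subset assms]]
  by (simp add: exterior_degree_def exterior_centraliser_def order_def)

lemma relative_commutativity_degree_eq_sum:
  assumes "finite (carrier G)"
  shows "relative_commutativity_degree G H =
    (\<Sum>n\<in>H. real (card (centraliser n))) / (real (order G) * real (card H))"
  using card_pairs_eq_sum_fibres[OF assms finite_subset[OF subset assms]]
  by (simp add: relative_commutativity_degree_def centraliser_def order_def)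

lemma exterior_degree_lower:
  assumes fin: "finite (carrier G)"
  defines "m \<equiv> real (card (schur_multiplier G H))"
  shows "relative_commutativity_degree G H / m
      + real (card (exterior_centre G H)) / real (order G) * (1 - 1 / m)
    \<le> exterior_degree G H"
proof -
  let ?Z = "exterior_centre G H"
  let ?o = "real (order G)" and ?h = "real (card H)"
  let ?S = "\<Sum>n\<in>H. real (card (centraliser n))"
  have finH: "finite H" using fin subset by (rule finite_subset[rotated])
  have "H \<noteq> {}" using subgroup.one_closed[OF subgroup_axioms] by blast
  then have h: "0 < ?h" using finH by (simp add: card_gt_0_iff)
  have ho: "?h \<le> ?o" using card_mono[OF fin subset] by (simp add: order_def)
  have ZH: "?Z \<subseteq> H" by (auto simp: exterior_centre_iff)
  \<comment> \<open>If \<open>m = 0\<close>, then \<open>1 / m\<close> is 0; otherwise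
    \<open>m\<close> is at least 1.\<close>
  have m: "0 \<le> 1 - 1 / m" by (auto simp: m_def divide_simps)
  \<comment> \<open>On the exterior centre both centralisers are the whole group, and the extra term
    is exactly what lifts \<open>?o / m\<close> to \<open>?o\<close>. Elsewhere this is the
    homomorphism bound divided by \<open>m\<close>.\<close>
  have pointwise: "real (card (centraliser n)) / m +
      (if n \<in> ?Z then ?o * (1 - 1 / m) else 0) \<le> real (card (exterior_centraliser n))"
    if n: "n \<in> H" for n
  proof (cases "n \<in> ?Z")
    case True
    then have "exterior_centraliser n = carrier G" "centraliser n = carrier G"
      using exterior_centre_subset by (auto simp: exterior_centre_iff relative_centre_iff)
    then show ?thesis using True by (simp add: order_def algebra_simps)
  next
    case False
    have "real (card (centraliser n)) \<le> m * real (card (exterior_centraliser n))" if "m > 0"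
    proof -
      \<comment> \<open>An infinite multiplier would give \<open>m = 0\<close>.\<close>
      have "finite (schur_multiplier G H)" using that card_ge_0_finite by (auto simp: m_def)
      then show ?thesis unfolding m_def using card_centraliser_le[OF n]
        by (metis of_nat_le_iff of_nat_mult)
    qed
    moreover have "m \<ge> 0" by (simp add: m_def)
    ultimately show ?thesis using False
      by (cases "m = 0") (auto simp: divide_simps mult.commute)
  qed
  have "?S / m + real (card ?Z) * (?o * (1 - 1 / m)) =
      (\<Sum>n\<in>H. real (card (centraliser n)) / m + (if n \<in> ?Z then ?o * (1 - 1 / m) else 0))"
    using finH ZH
    by (simp add: sum.distrib sum_divide_distrib sum.If_cases Int_absorb1)
  also have "\<dots> \<le> (\<Sum>n\<in>H. real (card (exterior_centraliser n)))"
    by (rule sum_mono) (rule pointwise)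
  finally have "(?S / m + real (card ?Z) * (?o * (1 - 1 / m))) / (?o * ?h) \<le> exterior_degree G H"
    using h ho by (simp add: exterior_degree_eq_sum[OF fin] divide_right_mono)
  moreover have "(?S / m + real (card ?Z) * (?o * (1 - 1 / m))) / (?o * ?h) =
      relative_commutativity_degree G H / m + real (card ?Z) / ?h * (1 - 1 / m)"
    using h ho by (simp add: relative_commutativity_degree_eq_sum[OF fin] add_divide_distrib mult.commute)
  \<comment> \<open>Summation gives the exterior centre term with the sharper denominator
    \<open>?h\<close>; it is weakened here to \<open>?o\<close>.\<close>
  moreover have "real (card ?Z) / ?o * (1 - 1 / m) \<le> real (card ?Z) / ?h * (1 - 1 / m)"
    using h ho m by (intro mult_right_mono divide_left_mono) auto
  ultimately show ?thesis by linarith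
qed

lemma exterior_degree_upper:
  assumes fin: "finite (carrier G)" and p: "0 < p"
    and least: "\<And>q. prime q \<Longrightarrow> q dvd order G \<Longrightarrow> p \<le> q"
  shows "exterior_degree G H \<le> relative_commutativity_degree G H
    - (real p - 1) / real p
      * ((real (card (relative_centre G H)) - real (card (exterior_centre G H))) / real (card H))"
proof -
  let ?Z = "exterior_centre G H" and ?C = "relative_centre G H"
  let ?o = "real (order G)" and ?h = "real (card H)" and ?r = "(real p - 1) / real p"
  let ?S = "\<Sum>n\<in>H. real (card (centraliser n))"
  have finH: "finite H" using fin subset by (rule finite_subset[rotated])
  have "H \<noteq> {}" using subgroup.one_closed[OF subgroup_axioms] by blast
  then have h: "0 < ?h" using finH by (simp add: card_gt_0_iff)
  have ho: "?h \<le> ?o" using card_mono[OF fin subset] by (simp add: order_def)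
  have CH: "?C \<subseteq> H" by (auto simp: relative_centre_iff)
  \<comment> \<open>For central \<open>n\<close> outside the exterior centre, the exterior
    centraliser is a proper subgroup, so it misses at least the fraction \<open>?r\<close> of the
    group.\<close>
  have pointwise: "real (card (exterior_centraliser n)) \<le>
      real (card (centraliser n)) - (if n \<in> ?C - ?Z then ?o * ?r else 0)" if n: "n \<in> H" for n
  proof (cases "n \<in> ?C - ?Z")
    case True
    then have C: "centraliser n = carrier G" and "exterior_centraliser n \<noteq> carrier G"
      by (auto simp: exterior_centre_iff relative_centre_iff)
    then have "p * card (exterior_centraliser n) \<le> order G"
      using proper_subgroup_card_le[OF fin subgroup_exterior_centraliser[OF n]] least by blast
    then have "real p * real (card (exterior_centraliser n)) \<le> ?o"
      by (metis of_nat_le_iff of_nat_mult)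
    \<comment> \<open>The right-hand side is \<open>?o / p\<close>, written in the form needed for
      the sum.\<close>
    then have "real (card (exterior_centraliser n)) \<le> ?o - ?o * ?r"
      using p by (simp add: field_simps)
    then show ?thesis using True C by (simp add: order_def)
  next
    case False
    have "finite (centraliser n)" using fin by (simp add: centraliser_def)
    then show ?thesis using False exterior_centraliser_subset[OF n]
      by (auto intro: card_mono)
  qed
  have card_diff: "real (card (?C - ?Z)) = real (card ?C) - real (card ?Z)"
    using exterior_centre_subset CH finH
    by (metis card_Diff_subset card_mono finite_subset of_nat_diff)
  have "(\<Sum>n\<in>H. real (card (exterior_centraliser n))) \<le>
      (\<Sum>n\<in>H. real (card (centraliser n)) - (if n \<in> ?C - ?Z then ?o * ?r else 0))"
    by (rule sum_mono) (rule pointwise)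
  also have "\<dots> = ?S - (\<Sum>n\<in>H. if n \<in> ?C - ?Z then ?o * ?r else 0)"
    by (rule sum_subtractf)
  also have "(\<Sum>n\<in>H. if n \<in> ?C - ?Z then ?o * ?r else 0) = (\<Sum>n\<in>?C - ?Z. ?o * ?r)"
    using finH CH by (intro sum.mono_neutral_cong_right) auto
  also have "\<dots> = (real (card ?C) - real (card ?Z)) * (?o * ?r)"
    by (simp add: card_diff)
  finally have "exterior_degree G H \<le>
      (?S - (real (card ?C) - real (card ?Z)) * (?o * ?r)) / (?o * ?h)"
    using h ho by (simp add: exterior_degree_eq_sum[OF fin] divide_right_mono)
  also have "\<dots> = relative_commutativity_degree G H - ?r * ((real (card ?C) - real (card ?Z)) / ?h)"
    using h ho p by (simp add: relative_commutativity_degree_eq_sum[OF fin] field_simps)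
  finally show ?thesis .
qed

end

theorem theorem3p6:
  fixes G :: "('a, 'b) monoid_scheme" and N :: "'a set" and p :: nat
  assumes "group G" and "finite (carrier G)" and "N \<lhd> G"
    and "prime p" and "p dvd order G"
    and "\<And>q. prime q \<Longrightarrow> q dvd order G \<Longrightarrow> p \<le> q"
  shows "(relative_commutativity_degree G N / real (card (schur_multiplier G N))
      + real (card (exterior_centre G N)) / real (card (carrier G))
        * (1 - 1 / real (card (schur_multiplier G N)))
      \<le> exterior_degree G N) \<and>
    (exterior_degree G N
      \<le> relative_commutativity_degree G N
        - ((real p - 1) / real p)
          * ((real (card (relative_centre G N)) - real (card (exterior_centre G N)))
             / real (card N)))"
  using normal.exterior_degree_lower[OF assms(3,2)]
    normal.exterior_degree_upper[OF assms(3,2) prime_gt_0_nat[OF assms(4)] assms(6)]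
  by (simp add: order_def)

end
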